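(* Let $C_{\max},D_{\max}\geq 0$ with $C_{\max}\le S_{\max}/\alpha_c$ and $D_{\max}\le\alpha_dS_{\max}$. Consider the problem of minimizing, over all policies $\pi=\{(G_i,C_i,D_i)\}$ admissible for the rate-constrained system described in the context, the cost $$J_G(\pi,S_1)=\limsup_{n\to\infty}\mathbb{E}\Big[\frac1n\sum_{i=1}^nG_i\Big]$$ where $\Delta_1,\Delta_2,\ldots$ is an arbitrary random process. Then the policy $\pi^{(3)}$ given by $$C_i^{(3)}=\min\{C_i^{(1)},C_{\max}\},\qquad D_i^{(3)}=\min\{D_i^{(1)},D_{\max}\},\qquad G_i^{(3)}=\min\{[C_i^{(3)}-D_i^{(3)}-\Delta_i]^+,G_{\max}\}$$ is optimal, where $C_i^{(1)},D_i^{(1)}$ are the functions of $(S_i,\Delta_i)$ defined in the context (evaluated at the current stored power $S_i$ and the current $\Delta_i$).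
   Context: Single-bus power system with storage in slotted time $i=1,2,\ldots$. Constants: charging efficiency $\alpha_c\in(0,1)$, discharging efficiency $\alpha_d\in(0,1)$, conventional generation capacity $G_{\max}\ge0$, power storage capacity $S_{\max}\ge0$, rated charging power $C_{\max}$ and rated discharging power $D_{\max}$. Notation $[x]^+=\max\{x,0\}$. The net renewable generation $\Delta_1,\Delta_2,\ldots$ is an exogenous real-valued random process (its law is not affected by the controls). The initial stored power $S_1\in[0,S_{\max}]$ is given. An admissible policy chooses $(G_i,C_i,D_i)$ (conventional generation, charging, discharging) as a measurable function of $(S_1,\Delta_1,\ldots,S_{i-1},\Delta_{i-1},S_i)$ and $\Delta_i$ such that for all $i$: $$S_{i+1}=S_i+\alpha_cC_i-\frac1{\alpha_d}D_i,\quad 0\le S_i\le S_{\max},\quad 0\le C_i\le C_{\max},\quad 0\le D_i\le D_{\max},\quad 0\le G_i\le G_{\max},$$ $$0\le G_i-C_i+D_i+\max\{\Delta_i,-G_{\max}-\min\{\alpha_dS_i,D_{\max}\}\}.$$ The functions $C^{(1)}_i,D^{(1)}_i$ of $(S_i,\Delta_i)$ are: - if $\frac{S_{\max}-S_i}{\alpha_c}\le\Delta_i$: $C^{(1)}_i=\frac{S_{\max}-S_i}{\alpha_c}$, $D^{(1)}_i=0$; - if $0\le\Delta_i<\frac{S_{\max}-S_i}{\alpha_c}$: $C^{(1)}_i=\Delta_i$, $D^{(1)}_i=0$; - if $-\alpha_dS_i\le\Delta_i<0$: $C^{(1)}_i=0$, $D^{(1)}_i=-\Delta_i$; - if $\Delta_i<-\alpha_dS_i$: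 $C^{(1)}_i=0$, $D^{(1)}_i=\alpha_dS_i$. Optimal means that $J_G(\pi^{(3)},S_1)\le J_G(\pi,S_1)$ for every admissible $\pi$. *)

theory Defs
  imports "HOL-Probability.Probability"
begin

record storage_system =
  \<alpha>\<^sub>c :: real
  \<alpha>\<^sub>d :: real
  G_max :: real
  S_max :: real
  C_max :: real
  D_max :: real

(* The decision in slot i is \<pi> i h, where h j = (S_j, \<Delta>_j) for j in {1..i}, so that h encodes
   (S_1, \<Delta>_1, ..., S_{i-1}, \<Delta>_{i-1}, S_i) together with the current \<Delta>_i.
   Slots are numbered from 1; the values at index 0 are irrelevant. *)
type_synonym history = "nat \<Rightarrow> real \<times> real"
type_synonym action = "real \<times> real \<times> real"
type_synonym policy = "nat \<Rightarrow> history \<Rightarrow> action"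

abbreviation generation :: "action \<Rightarrow> real" where
  "generation a \<equiv> fst a"

abbreviation charging :: "action \<Rightarrow> real" where
  "charging a \<equiv> fst (snd a)"

abbreviation discharging :: "action \<Rightarrow> real" where
  "discharging a \<equiv> snd (snd a)"

lemma restrict_fundef_cong [fundef_cong]:
  "I = J \<Longrightarrow> (\<And>i. i \<in> J \<Longrightarrow> f i = g i) \<Longrightarrow> restrict f I = restrict g J"
  by (auto simp: restrict_def)

(* Stored power along one sample path \<delta> of the net renewable generation, from S_1 = s. *)
function stored :: "storage_system \<Rightarrow> policy \<Rightarrow> real \<Rightarrow> (nat \<Rightarrow> real) \<Rightarrow> nat \<Rightarrow> real" where
  "stored P \<pi> s \<delta> 0 = s"
| "stored P \<pi> s \<delta> (Suc i) =
     (if i = 0 then s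
      else let a = \<pi> i (\<lambda>j\<in>{1..i}. (stored P \<pi> s \<delta> j, \<delta> j))
           in stored P \<pi> s \<delta> i + \<alpha>\<^sub>c P * charging a - (1 / \<alpha>\<^sub>d P) * discharging a)"
  by pat_completeness auto
termination
  by (relation "Wellfounded.measure (\<lambda>(P, \<pi>, s, \<delta>, i). i)") auto

definition history :: "storage_system \<Rightarrow> policy \<Rightarrow> real \<Rightarrow> (nat \<Rightarrow> real) \<Rightarrow> nat \<Rightarrow> history" where
  "history P \<pi> s \<delta> i = (\<lambda>j\<in>{1..i}. (stored P \<pi> s \<delta> j, \<delta> j))"

definition decision :: "storage_system \<Rightarrow> policy \<Rightarrow> real \<Rightarrow> (nat \<Rightarrow> real) \<Rightarrow> nat \<Rightarrow> action" where
  "decision P \<pi> s \<delta> i = \<pi> i (history P \<pi> s \<delta> i)"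

definition feasible :: "storage_system \<Rightarrow> real \<Rightarrow> real \<Rightarrow> action \<Rightarrow> bool" where
  "feasible P S d a \<longleftrightarrow> (case a of (G, C, D) \<Rightarrow>
     0 \<le> S \<and> S \<le> S_max P \<and>
     0 \<le> C \<and> C \<le> C_max P \<and>
     0 \<le> D \<and> D \<le> D_max P \<and>
     0 \<le> G \<and> G \<le> G_max P \<and>
     0 \<le> G - C + D + max d (- G_max P - min (\<alpha>\<^sub>d P * S) (D_max P)))"

(* The storage recursion holds by construction of the trajectory; the constraints are required
   almost surely, in all slots simultaneously. *)
definition admissible ::
  "storage_system \<Rightarrow> 'a measure \<Rightarrow> (nat \<Rightarrow> 'a \<Rightarrow> real) \<Rightarrow> real \<Rightarrow> policy \<Rightarrow> bool" where
  "admissible P M \<Delta> s \<pi> \<longleftrightarrow>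
     (\<forall>i\<ge>1. \<pi> i \<in> measurable (\<Pi>\<^sub>M j\<in>{1..i}. borel) borel) \<and>
     (AE \<omega> in M. \<forall>i\<ge>1.
        feasible P (stored P \<pi> s (\<lambda>j. \<Delta> j \<omega>) i) (\<Delta> i \<omega>) (decision P \<pi> s (\<lambda>j. \<Delta> j \<omega>) i))"

definition J_G ::
  "storage_system \<Rightarrow> 'a measure \<Rightarrow> (nat \<Rightarrow> 'a \<Rightarrow> real) \<Rightarrow> policy \<Rightarrow> real \<Rightarrow> ereal" where
  "J_G P M \<Delta> \<pi> s =
     limsup (\<lambda>n. ereal (\<integral>\<omega>. (1 / real n) *
       (\<Sum>i=1..n. generation (decision P \<pi> s (\<lambda>j. \<Delta> j \<omega>) i)) \<partial>M))"

definition optimal ::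
  "storage_system \<Rightarrow> 'a measure \<Rightarrow> (nat \<Rightarrow> 'a \<Rightarrow> real) \<Rightarrow> real \<Rightarrow> policy \<Rightarrow> bool" where
  "optimal P M \<Delta> s \<pi> \<longleftrightarrow>
     admissible P M \<Delta> s \<pi> \<and>
     (\<forall>\<pi>'. admissible P M \<Delta> s \<pi>' \<longrightarrow> J_G P M \<Delta> \<pi> s \<le> J_G P M \<Delta> \<pi>' s)"

(* The cases are (S_max - S)/alpha_c <= d; 0 <= d < (S_max - S)/alpha_c; -alpha_d S <= d < 0;
   d < -alpha_d S. They partition the line when 0 <= S <= S_max; other values of S do not occur
   under the policy below. *)
definition C1 :: "storage_system \<Rightarrow> real \<Rightarrow> real \<Rightarrow> real" where
  "C1 P S d =
     (if (S_max P - S) / \<alpha>\<^sub>c P \<le> d then (S_max P - S) / \<alpha>\<^sub>c P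
      else if 0 \<le> d then d
      else if - \<alpha>\<^sub>d P * S \<le> d then 0
      else 0)"

definition D1 :: "storage_system \<Rightarrow> real \<Rightarrow> real \<Rightarrow> real" where
  "D1 P S d =
     (if (S_max P - S) / \<alpha>\<^sub>c P \<le> d then 0
      else if 0 \<le> d then 0
      else if - \<alpha>\<^sub>d P * S \<le> d then - d
      else \<alpha>\<^sub>d P * S)"

definition C3 :: "storage_system \<Rightarrow> real \<Rightarrow> real \<Rightarrow> real" where
  "C3 P S d = min (C1 P S d) (C_max P)"

definition D3 :: "storage_system \<Rightarrow> real \<Rightarrow> real \<Rightarrow> real" where
  "D3 P S d = min (D1 P S d) (D_max P)"

definition G3 :: "storage_system \<Rightarrow> real \<Rightarrow> real \<Rightarrow> real" where
  "G3 P S d = min (max (C3 P S d - D3 P S d - d) 0) (G_max P)"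

definition policy3 :: "storage_system \<Rightarrow> policy" where
  "policy3 P i h = (case h i of (S, d) \<Rightarrow> (G3 P S d, C3 P S d, D3 P S d))"

end

theory Submission
  imports Defs
begin

text \<open>
  Optimality holds along every sample path and at every horizon. Let \<open>U\<close> be the total generation of
  a competing policy minus that of \<open>\<pi>\<^sup>(\<^sup>3\<^sup>)\<close>, and let \<open>S'\<close> and \<open>S\<close> be their stored powers. The invariant
  \<open>U \<ge> max {0, \<alpha>\<^sub>d (S' - S)}\<close> is preserved in every slot: a unit of stored power can save at most
  \<open>\<alpha>\<^sub>d\<close> units of generation later, whereas having it in excess of \<open>\<pi>\<^sup>(\<^sup>3\<^sup>)\<close> costs at least \<open>\<alpha>\<^sub>d\<close> units of
  generation, either directly or because a possible discharge was withheld.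
\<close>

section \<open>Measurability of trajectories and integrability of generation\<close>

lemma stored_Suc:
  assumes "1 \<le> i"
  shows "stored P \<pi> s \<delta> (Suc i) = stored P \<pi> s \<delta> i
    + \<alpha>\<^sub>c P * charging (decision P \<pi> s \<delta> i) - discharging (decision P \<pi> s \<delta> i) / \<alpha>\<^sub>d P"
  using assms by (simp add: Let_def decision_def history_def)

lemma decision_policy3:
  assumes "1 \<le> i"
  shows "decision P (policy3 P) s \<delta> i =
    (G3 P (stored P (policy3 P) s \<delta> i) (\<delta> i), C3 P (stored P (policy3 P) s \<delta> i) (\<delta> i),
     D3 P (stored P (policy3 P) s \<delta> i) (\<delta> i))"
  using assms by (simp add: decision_def history_def policy3_def)

text \<open>A decision sees all stored powers up to its slot, and the next stored power depends on
  that decision. Hence \<open>dec\<close> takes the measurability of the stored powers as a premise,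
  and \<open>st\<close> discharges it by strong induction on the slot.\<close>

lemma measurable_stored:
  assumes \<pi>: "\<And>i. 1 \<le> i \<Longrightarrow> \<pi> i \<in> measurable (\<Pi>\<^sub>M j\<in>{1..i}. borel) borel"
    and \<Delta>: "\<And>i. 1 \<le> i \<Longrightarrow> \<Delta> i \<in> borel_measurable M"
  shows "(\<lambda>\<omega>. stored P \<pi> s (\<lambda>j. \<Delta> j \<omega>) i) \<in> borel_measurable M"
    and "1 \<le> i \<Longrightarrow> (\<lambda>\<omega>. decision P \<pi> s (\<lambda>j. \<Delta> j \<omega>) i) \<in> borel_measurable M"
proof -
  have dec: "(\<lambda>\<omega>. decision P \<pi> s (\<lambda>j. \<Delta> j \<omega>) i) \<in> borel_measurable M"
    if "1 \<le> i" and st: "\<And>j. j \<le> i \<Longrightarrow> (\<lambda>\<omega>. stored P \<pi> s (\<lambda>j. \<Delta> j \<omega>) j) \<in> borel_measurable M"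
    for i
    unfolding decision_def history_def
    by (rule measurable_compose[OF _ \<pi>[OF \<open>1 \<le> i\<close>]], rule measurable_restrict)
      (auto intro!: borel_measurable_Pair st \<Delta>)
  have st: "(\<lambda>\<omega>. stored P \<pi> s (\<lambda>j. \<Delta> j \<omega>) i) \<in> borel_measurable M" for i
  proof (induction i rule: less_induct)
    case (less i)
    consider "i = 0" | "i = Suc 0" | k where "i = Suc k" "1 \<le> k"
      by (cases i) (auto simp: Suc_le_eq)
    then show ?case
    proof cases
      case 3
      have [measurable]: "(\<lambda>\<omega>. decision P \<pi> s (\<lambda>j. \<Delta> j \<omega>) k) \<in> borel_measurable M"
        using 3 by (intro dec less) auto
      have [measurable]: "(\<lambda>\<omega>. stored P \<pi> s (\<lambda>j. \<Delta> j \<omega>) k) \<in> borel_measurable M"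
        using 3 by (intro less) auto
      have [measurable]: "charging \<in> borel_measurable borel" "discharging \<in> borel_measurable borel"
        by (auto intro!: borel_measurable_continuous_onI continuous_intros)
      show ?thesis
        unfolding 3(1) stored_Suc[OF 3(2)] by measurable
    qed auto
  qed
  show "(\<lambda>\<omega>. stored P \<pi> s (\<lambda>j. \<Delta> j \<omega>) i) \<in> borel_measurable M"
    by (rule st)
  show "(\<lambda>\<omega>. decision P \<pi> s (\<lambda>j. \<Delta> j \<omega>) i) \<in> borel_measurable M" if "1 \<le> i"
    using that st by (rule dec)
qed

lemma measurable_policy3:
  assumes "1 \<le> i"
  shows "policy3 P i \<in> measurable (\<Pi>\<^sub>M j\<in>{1..i}. borel) borel"
proof -
  have [measurable]: "(\<lambda>h. h i) \<in> measurable (\<Pi>\<^sub>M j\<in>{1..i}. borel :: (real \<times> real) measure) borel"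
    using assms by (intro measurable_component_singleton) auto
  have [measurable]: "(fst :: real \<times> real \<Rightarrow> real) \<in> borel_measurable borel"
      "(snd :: real \<times> real \<Rightarrow> real) \<in> borel_measurable borel"
    by (auto intro!: borel_measurable_continuous_onI continuous_intros)
  show ?thesis
    unfolding policy3_def case_prod_beta G3_def C3_def D3_def C1_def D1_def
    by (intro borel_measurable_Pair) measurable
qed

text \<open>Monotonicity of the Bochner integral, used below to compare costs, needs integrability
  on both sides. Almost surely each generation lies between 0 and \<open>G_max P\<close>, which
  suffices on a probability space.\<close>

lemma integrable_mean_generation:
  assumes "prob_space M" and \<Delta>: "\<And>i. 1 \<le> i \<Longrightarrow> \<Delta> i \<in> borel_measurable M"
    and adm: "admissible P M \<Delta> s \<pi>"
  shows "integrable M (\<lambda>\<omega>. (1 / real n) *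
    (\<Sum>i=1..n. generation (decision P \<pi> s (\<lambda>j. \<Delta> j \<omega>) i)))"
proof -
  interpret prob_space M by fact
  have [measurable]: "generation \<in> borel_measurable borel"
    by (auto intro!: borel_measurable_continuous_onI continuous_intros)
  have "integrable M (\<lambda>\<omega>. generation (decision P \<pi> s (\<lambda>j. \<Delta> j \<omega>) i))" if "1 \<le> i" for i
  proof (rule integrable_const_bound[where B = "G_max P"])
    show "AE \<omega> in M. norm (generation (decision P \<pi> s (\<lambda>j. \<Delta> j \<omega>) i)) \<le> G_max P"
      using adm that unfolding admissible_def
      by (elim conjE AE_mp) (auto simp: feasible_def case_prod_beta)
    have [measurable]: "(\<lambda>\<omega>. decision P \<pi> s (\<lambda>j. \<Delta> j \<omega>) i) \<in> borel_measurable M"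
      using adm \<Delta> that by (intro measurable_stored) (auto simp: admissible_def)
    show "(\<lambda>\<omega>. generation (decision P \<pi> s (\<lambda>j. \<Delta> j \<omega>) i)) \<in> borel_measurable M"
      by measurable
  qed
  then show ?thesis
    by (intro integrable_mult_right integrable_sum) auto
qed

section \<open>Feasibility of the candidate policy\<close>

locale storage =
  fixes P :: storage_system
  assumes \<alpha>\<^sub>c: "0 < \<alpha>\<^sub>c P" "\<alpha>\<^sub>c P \<le> 1"
    and \<alpha>\<^sub>d: "0 < \<alpha>\<^sub>d P" "\<alpha>\<^sub>d P \<le> 1"
    and G_max: "0 \<le> G_max P" and C_max: "0 \<le> C_max P" and D_max: "0 \<le> D_max P"
begin

text \<open>Once the stored power is within its bounds, the cases of \<open>C1\<close> and
  \<open>D1\<close> collapse to the sign of \<open>d\<close>. In a surplus the charge never exceeds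
  \<open>d\<close>, so nothing has to be generated.\<close>

lemma C3_D3_surplus:
  assumes "0 \<le> d" "0 \<le> S" "S \<le> S_max P"
  shows "C3 P S d = min (min d ((S_max P - S) / \<alpha>\<^sub>c P)) (C_max P)" "D3 P S d = 0" "G3 P S d = 0"
  using assms \<alpha>\<^sub>c \<alpha>\<^sub>d D_max G_max by (auto simp: C3_def D3_def G3_def C1_def D1_def)

lemma C3_D3_deficit:
  assumes "d < 0" "0 \<le> S" "S \<le> S_max P"
  shows "C3 P S d = 0" "D3 P S d = min (min (- d) (\<alpha>\<^sub>d P * S)) (D_max P)"
    "G3 P S d = min (- d - min (min (- d) (\<alpha>\<^sub>d P * S)) (D_max P)) (G_max P)"
proof -
  have "\<not> (S_max P - S) / \<alpha>\<^sub>c P \<le> d"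
    using assms \<alpha>\<^sub>c divide_nonneg_pos[of "S_max P - S" "\<alpha>\<^sub>c P"] by linarith
  then show C: "C3 P S d = 0" and D: "D3 P S d = min (min (- d) (\<alpha>\<^sub>d P * S)) (D_max P)"
    using assms C_max by (auto simp: C3_def D3_def C1_def D1_def)
  show "G3 P S d = min (- d - min (min (- d) (\<alpha>\<^sub>d P * S)) (D_max P)) (G_max P)"
    unfolding G3_def C D by auto
qed

text \<open>Only the balance in a deficit is delicate. Either generation covers what the discharge
  leaves of \<open>- d\<close>, or it saturates at \<open>G_max P\<close>; in the latter case the
  truncation \<open>max d (- G_max P - min ...)\<close> sheds the load that cannot be met.\<close>

lemma feasible_policy3:
  assumes "0 \<le> S" "S \<le> S_max P"
  shows "feasible P S d (G3 P S d, C3 P S d, D3 P S d)"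
proof (cases "0 \<le> d")
  case True
  have "0 \<le> (S_max P - S) / \<alpha>\<^sub>c P"
    using assms \<alpha>\<^sub>c by simp
  then show ?thesis
    using True assms C_max D_max G_max by (auto simp: feasible_def C3_D3_surplus)
next
  case False
  have "0 \<le> \<alpha>\<^sub>d P * S"
    using assms \<alpha>\<^sub>d by simp
  then show ?thesis
    using False assms C_max D_max G_max
    by (auto simp: feasible_def C3_D3_deficit min_def max_def)
qed

lemma stored_policy3_step:
  assumes "0 \<le> S" "S \<le> S_max P"
  shows "0 \<le> S + \<alpha>\<^sub>c P * C3 P S d - D3 P S d / \<alpha>\<^sub>d P"
    and "S + \<alpha>\<^sub>c P * C3 P S d - D3 P S d / \<alpha>\<^sub>d P \<le> S_max P"
proof -
  have "D3 P S d \<le> \<alpha>\<^sub>d P * S" "C3 P S d \<le> (S_max P - S) / \<alpha>\<^sub>c P"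
    using assms \<alpha>\<^sub>c \<alpha>\<^sub>d by (cases "0 \<le> d"; simp add: C3_D3_surplus C3_D3_deficit)+
  then have *: "D3 P S d / \<alpha>\<^sub>d P \<le> S" "\<alpha>\<^sub>c P * C3 P S d \<le> S_max P - S"
    using \<alpha>\<^sub>c \<alpha>\<^sub>d by (simp_all add: field_simps)
  have "0 \<le> C3 P S d" "0 \<le> D3 P S d"
    using feasible_policy3[OF assms, of d] by (auto simp: feasible_def)
  then have "0 \<le> \<alpha>\<^sub>c P * C3 P S d" "0 \<le> D3 P S d / \<alpha>\<^sub>d P"
    using \<alpha>\<^sub>c \<alpha>\<^sub>d by auto
  with * show "0 \<le> S + \<alpha>\<^sub>c P * C3 P S d - D3 P S d / \<alpha>\<^sub>d P"
    and "S + \<alpha>\<^sub>c P * C3 P S d - D3 P S d / \<alpha>\<^sub>d P \<le> S_max P"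
    by auto
qed

lemma stored_policy3_bounds:
  assumes "0 \<le> s" "s \<le> S_max P"
  shows "0 \<le> stored P (policy3 P) s \<delta> i \<and> stored P (policy3 P) s \<delta> i \<le> S_max P"
proof (induction i)
  case 0
  then show ?case using assms by simp
next
  case (Suc i)
  show ?case
  proof (cases "i = 0")
    case True
    then show ?thesis using assms by simp
  next
    case False
    then have "1 \<le> i" by simp
    then show ?thesis
      unfolding stored_Suc[OF \<open>1 \<le> i\<close>] using Suc stored_policy3_step
      by (simp add: decision_policy3)
  qed
qed

lemma admissible_policy3:
  assumes "0 \<le> s" "s \<le> S_max P"
  shows "admissible P M \<Delta> s (policy3 P)"
  unfolding admissible_def
  using measurable_policy3 stored_policy3_bounds[OF assms]
  by (simp add: decision_policy3 feasible_policy3 del: One_nat_def)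

section \<open>Pathwise comparison and passage to the cost\<close>

text \<open>This is the induction step of the invariant, for arbitrary stored powers and accumulated
  advantage \<open>U\<close>. The bounds on the competitor's next stored power are separate premises
  because \<open>feasible\<close> constrains only the current one.\<close>

lemma generation_potential_step:
  assumes S: "0 \<le> S" "S \<le> S_max P"
    and feas: "feasible P S' d (G, C, D)"
    and next_nonneg: "0 \<le> S' + \<alpha>\<^sub>c P * C - D / \<alpha>\<^sub>d P"
    and next_le: "S' + \<alpha>\<^sub>c P * C - D / \<alpha>\<^sub>d P \<le> S_max P"
    and U: "0 \<le> U" "\<alpha>\<^sub>d P * (S' - S) \<le> U"
  shows "0 \<le> U + G - G3 P S d"
    and "\<alpha>\<^sub>d P * ((S' + \<alpha>\<^sub>c P * C - D / \<alpha>\<^sub>d P) - (S + \<alpha>\<^sub>c P * C3 P S d - D3 P S d / \<alpha>\<^sub>d P))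
      \<le> U + G - G3 P S d"
proof -
  \<comment> \<open>Stored power is measured by what it can deliver, \<open>a\<close> and
    \<open>a'\<close>; \<open>r\<close> is the round-trip efficiency. With \<open>r * C\<close>
    treated as an atom, \<open>scale\<close> makes the next states linear.\<close>
  define a where "a = \<alpha>\<^sub>d P * S"
  define a' where "a' = \<alpha>\<^sub>d P * S'"
  define r where "r = \<alpha>\<^sub>d P * \<alpha>\<^sub>c P"
  have r: "0 \<le> r" "r \<le> 1"
    using \<alpha>\<^sub>c \<alpha>\<^sub>d by (auto simp: r_def intro: mult_le_one)
  have bounds: "0 \<le> C" "C \<le> C_max P" "0 \<le> D" "D \<le> D_max P" "0 \<le> G" "G \<le> G_max P"
    and bal: "0 \<le> G - C + D + max d (- G_max P - min a' (D_max P))"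
    using feas by (auto simp: feasible_def a'_def)
  have scale: "\<alpha>\<^sub>d P * (x + \<alpha>\<^sub>c P * y - z / \<alpha>\<^sub>d P) = \<alpha>\<^sub>d P * x + r * y - z" for x y z
    using \<alpha>\<^sub>d by (simp add: r_def field_simps)
  have U': "a' - a \<le> U"
    using U by (simp add: a_def a'_def algebra_simps)
  \<comment> \<open>The competitor may charge and discharge in the same slot, so its discharge is
    bounded by \<open>a'\<close> only net of \<open>r * C\<close>.\<close>
  have draw: "D - r * C \<le> a'"
    using mult_nonneg_nonneg[OF _ next_nonneg, of "\<alpha>\<^sub>d P"] \<alpha>\<^sub>d by (simp add: scale a'_def)
  have rC: "r * C \<le> C" "0 \<le> r * C"
    using r bounds by (auto intro: mult_left_le_one_le)
  have "0 \<le> U + G - G3 P S d \<and>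
    a' + r * C - D - (a + r * C3 P S d - D3 P S d) \<le> U + G - G3 P S d"
  proof (cases "0 \<le> d")
    case True
    note surplus = C3_D3_surplus[OF True S]
    have a0: "0 \<le> a'"
      using feas \<alpha>\<^sub>d by (auto simp: feasible_def a'_def)
    have bal': "C - D - d \<le> G"
      using bal True a0 G_max D_max by (auto simp: max_def min_def split: if_splits)
    consider "C3 P S d = d" | "C3 P S d = (S_max P - S) / \<alpha>\<^sub>c P" | "C3 P S d = C_max P"
      unfolding surplus by linarith
    then have "a' + r * C - D - (a + r * C3 P S d - D3 P S d) \<le> U + G"
    proof cases
      case 1
      \<comment> \<open>Charging beyond the surplus must be paid for by generation or discharge, at
        a gain of only \<open>r\<close> \<le> 1 per unit.\<close>
      have "r * (C - d) - D \<le> G"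
      proof (cases "d \<le> C")
        case True
        then have "r * (C - d) \<le> C - d"
          using r by (intro mult_left_le_one_le) auto
        then show ?thesis using bal' by linarith
      next
        case False
        then have "r * (C - d) \<le> 0"
          using r by (intro mult_nonneg_nonpos) auto
        then show ?thesis using bounds by linarith
      qed
      then show ?thesis
        using 1 U' by (simp add: surplus algebra_simps)
    next
      case 2
      \<comment> \<open>Here \<open>policy3\<close> fills the storage, so the competitor cannot end
        the slot with more.\<close>
      have "a' + r * C - D \<le> \<alpha>\<^sub>d P * S_max P"
        using mult_left_mono[OF next_le, of "\<alpha>\<^sub>d P"] \<alpha>\<^sub>d by (simp add: scale a'_def)
      also have "S_max P = S + \<alpha>\<^sub>c P * C3 P S d"
        using 2 \<alpha>\<^sub>c by simp
      also have "\<alpha>\<^sub>d P * \<dots> = a + r * C3 P S d"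
        by (simp add: a_def r_def distrib_left)
      finally show ?thesis
        using U bounds by (simp add: surplus)
    next
      case 3
      have "r * C \<le> r * C3 P S d"
        using 3 bounds r by (intro mult_left_mono) auto
      then show ?thesis
        using U' bounds by (simp add: surplus)
    qed
    then show ?thesis
      using U bounds by (simp add: surplus)
  next
    case False
    then have d: "d < 0" by simp
    note deficit = C3_D3_deficit[OF d S, folded a_def]
    \<comment> \<open>If the maximum in \<open>bal\<close> is \<open>d\<close>, then G \<ge> C - D -
      d: the second claim follows from \<open>U'\<close>, and the first from \<open>draw\<close> or
      D \<le> D_max unless \<open>G3\<close> vanishes. Otherwise load is shed, and
      \<open>bal\<close> with \<open>draw\<close> or D \<le> D_max forces G \<ge> G_max; the second
      claim then uses \<open>U'\<close> if D_max attains the inner minimum, and U \<ge> 0 if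
      \<open>a'\<close> does.\<close>
    show ?thesis
      unfolding deficit using bal bounds U U' rC draw d
      by (auto simp: min_def max_def split: if_splits)
  qed
  then show "0 \<le> U + G - G3 P S d"
    and "\<alpha>\<^sub>d P * ((S' + \<alpha>\<^sub>c P * C - D / \<alpha>\<^sub>d P) - (S + \<alpha>\<^sub>c P * C3 P S d - D3 P S d / \<alpha>\<^sub>d P))
      \<le> U + G - G3 P S d"
    \<comment> \<open>The instance distributes only over the difference of the two next states,
      leaving each in the shape that \<open>scale\<close> rewrites.\<close>
    by (auto simp: right_diff_distrib[of "\<alpha>\<^sub>d P" "_ - _" "_ - _"] scale a_def a'_def)
qed

lemma sum_generation_policy3_le:
  assumes s: "0 \<le> s" "s \<le> S_max P"
    and feas: "\<And>i. 1 \<le> i \<Longrightarrow> feasible P (stored P \<pi> s \<delta> i) (\<delta> i) (decision P \<pi> s \<delta> i)"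
  shows "(\<Sum>i=1..n. generation (decision P (policy3 P) s \<delta> i))
    \<le> (\<Sum>i=1..n. generation (decision P \<pi> s \<delta> i))"
proof -
  define U where "U n = (\<Sum>i=1..n. generation (decision P \<pi> s \<delta> i))
    - (\<Sum>i=1..n. generation (decision P (policy3 P) s \<delta> i))" for n
  \<comment> \<open>\<open>U n\<close> accounts for slots 1 to \<open>n\<close>, so it is paired
    with the stored powers at the start of slot \<open>Suc n\<close>; for \<open>n = 0\<close> both
    equal \<open>s\<close>.\<close>
  have "0 \<le> U n \<and>
    \<alpha>\<^sub>d P * (stored P \<pi> s \<delta> (Suc n) - stored P (policy3 P) s \<delta> (Suc n)) \<le> U n"
  proof (induction n)
    case 0
    then show ?case by (simp add: U_def)
  next
    case (Suc n)
    define S where "S = stored P (policy3 P) s \<delta> (Suc n)"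
    define S' where "S' = stored P \<pi> s \<delta> (Suc n)"
    define a where "a = decision P \<pi> s \<delta> (Suc n)"
    have S: "0 \<le> S" "S \<le> S_max P"
      unfolding S_def using stored_policy3_bounds[OF s] by blast+
    have f: "feasible P S' (\<delta> (Suc n)) (generation a, charging a, discharging a)"
      using feas[of "Suc n"] by (simp add: S'_def a_def)
    have S'_next: "stored P \<pi> s \<delta> (Suc (Suc n))
        = S' + \<alpha>\<^sub>c P * charging a - discharging a / \<alpha>\<^sub>d P"
      unfolding S'_def a_def by (rule stored_Suc) simp
    have S_next: "stored P (policy3 P) s \<delta> (Suc (Suc n))
        = S + \<alpha>\<^sub>c P * C3 P S (\<delta> (Suc n)) - D3 P S (\<delta> (Suc n)) / \<alpha>\<^sub>d P"
      unfolding S_def by (subst stored_Suc) (simp_all add: decision_policy3 del: stored.simps)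
    \<comment> \<open>These bounds come from feasibility one slot later, possibly beyond the horizon
      of the sum.\<close>
    have S'_bounds: "0 \<le> S' + \<alpha>\<^sub>c P * charging a - discharging a / \<alpha>\<^sub>d P"
        "S' + \<alpha>\<^sub>c P * charging a - discharging a / \<alpha>\<^sub>d P \<le> S_max P"
      using feas[of "Suc (Suc n)"] unfolding S'_next by (auto simp: feasible_def)
    have U_Suc: "U (Suc n) = U n + generation a - G3 P S (\<delta> (Suc n))"
      by (simp add: U_def a_def S_def decision_policy3 del: stored.simps)
    show ?case
      unfolding S'_next S_next U_Suc
      using generation_potential_step[OF S f S'_bounds] Suc by (simp add: S_def S'_def)
  qed
  then show ?thesis by (simp add: U_def)
qed

text \<open>Since the comparison holds at every horizon on almost every path, it passes to
  expectations and then to the limsup. One null set serves all slots, because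
  \<open>admissible\<close> quantifies over them inside the almost-sure statement.\<close>

lemma J_G_policy3_le:
  assumes "prob_space M" and "\<And>i. 1 \<le> i \<Longrightarrow> \<Delta> i \<in> borel_measurable M"
    and s: "0 \<le> s" "s \<le> S_max P" and adm: "admissible P M \<Delta> s \<pi>"
  shows "J_G P M \<Delta> (policy3 P) s \<le> J_G P M \<Delta> \<pi> s"
  unfolding J_G_def
proof (intro Limsup_mono always_eventually allI, unfold ereal_less_eq,
    rule integral_mono_AE)
  fix n
  have "AE \<omega> in M. \<forall>i\<ge>1.
      feasible P (stored P \<pi> s (\<lambda>j. \<Delta> j \<omega>) i) (\<Delta> i \<omega>) (decision P \<pi> s (\<lambda>j. \<Delta> j \<omega>) i)"
    using adm unfolding admissible_def by blast
  then show "AE \<omega> in M.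
    1 / real n * (\<Sum>i=1..n. generation (decision P (policy3 P) s (\<lambda>j. \<Delta> j \<omega>) i))
      \<le> 1 / real n * (\<Sum>i=1..n. generation (decision P \<pi> s (\<lambda>j. \<Delta> j \<omega>) i))"
  proof eventually_elim
    case (elim \<omega>)
    then show ?case
      by (intro mult_left_mono sum_generation_policy3_le s) simp_all
  qed
qed (rule integrable_mean_generation[OF assms(1,2) admissible_policy3[OF s]]
    integrable_mean_generation[OF assms(1,2) adm]; assumption)+

end

theorem theorem3:
  fixes P :: storage_system
    and M :: "'a measure"
    and \<Delta> :: "nat \<Rightarrow> 'a \<Rightarrow> real"
    and S\<^sub>1 :: real
  assumes "0 < \<alpha>\<^sub>c P" "\<alpha>\<^sub>c P < 1"
    and "0 < \<alpha>\<^sub>d P" "\<alpha>\<^sub>d P < 1"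
    and "0 \<le> G_max P" "0 \<le> S_max P"
    and "0 \<le> C_max P" "0 \<le> D_max P"
    and "C_max P \<le> S_max P / \<alpha>\<^sub>c P"
    and "D_max P \<le> \<alpha>\<^sub>d P * S_max P"
    and "prob_space M"
    and "\<And>i. 1 \<le> i \<Longrightarrow> \<Delta> i \<in> borel_measurable M"
    and "0 \<le> S\<^sub>1" "S\<^sub>1 \<le> S_max P"
  shows "optimal P M \<Delta> S\<^sub>1 (policy3 P)"
proof -
  interpret storage P
    using assms(1-8) by unfold_locales auto
  show ?thesis
    unfolding optimal_def
    using admissible_policy3 J_G_policy3_le assms(11-14) by blast
qed

end
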